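(* Let $(\mathbf A,\boldsymbol b,\boldsymbol c)$ be an $s$-stage explicit Runge--Kutta (ERK) method and let $p\ge 1$ be an integer. With the vectors $\boldsymbol q_k,\boldsymbol d_k$, the spaces $Q_k,D_k$, and the elementary weight vectors $\boldsymbol\Phi(t)$ defined in the context, suppose that there are integers $m,n\ge 1$ with $m\ge n-1$ and $m+n+1\ge p$ such that the following six conditions hold: 1. ($B(p)$) $\boldsymbol b\cdot \boldsymbol c^{\odot(k-1)}=\frac1k$ for $k=1,\dots,p$. 2. ($QO(m)$) $\boldsymbol b\odot \boldsymbol q=\boldsymbol 0$ for all $\boldsymbol q\in Q_m$. 3. ($DO(n)$) $\boldsymbol d\cdot \boldsymbol c^{\odot(k-1)}=0$ for all $\boldsymbol d\in D_n$ and all $k=1,\dots,p-n$. 4. ($QD_{\mathrm{weak}}(m,n)$) $\boldsymbol q\cdot\boldsymbol d=0$ for all $\boldsymbol q\in Q_m$ and $\boldsymbol d\in D_n$. 5. ($PR(n)$) Let $$W_n=\{(\boldsymbol q\odot\boldsymbol d)\times^1\mathbf A-\boldsymbol q\odot(\boldsymbol d\times^1\mathbf A)\ :\ \boldsymbol q\in Q_{l_1},\ \boldsymbol d\in D_{l_2},\ l_1+l_2\le n-1\}.$$ Then $\boldsymbol w\cdot\boldsymbol\Phi(t)=0$ for all $\boldsymbol w\in W_n$ and all rooted trees $t$ with $m+1\le |t|\le p-3$. 6. ($QR(m)$) For all $m_2\le m_1\le m$, $\ Q_{m_1}\odot Q_{m_2}\subseteq Q_{m_1}$, i.e. $\boldsymbol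 q\odot\boldsymbol q'\in Q_{m_1}$ for all $\boldsymbol q\in Q_{m_1}$, $\boldsymbol q'\in Q_{m_2}$. Then the ERK method has order at least $p$.
   Context: An $s$-stage explicit Runge--Kutta method is given by a strictly lower triangular real matrix $\mathbf A\in\mathbb R^{s\times s}$, a weight vector $\boldsymbol b\in\mathbb R^s$ and a stage vector $\boldsymbol c\in\mathbb R^s$. Notation: $\odot$ is the Hadamard (entrywise) product; $\boldsymbol c^{\odot k}$ is the entrywise $k$-th power, with $\boldsymbol c^{\odot 0}=\boldsymbol 1$ (the all-ones vector); $\boldsymbol u\cdot\boldsymbol v=\boldsymbol u^\top\boldsymbol v$; $\boldsymbol d\times^1\mathbf A=\mathbf A^\top\boldsymbol d$, i.e. the row vector $\boldsymbol d^\top\mathbf A$ regarded as a vector. An operation applied to a subspace (e.g. $\mathbf AQ$, $D\times^1\mathbf A$, $D\odot\boldsymbol c$) means applying it to every element. For integers $k\ge0$ define $$\boldsymbol q_k=\mathbf A\boldsymbol c^{\odot k}-\tfrac1{k+1}\boldsymbol c^{\odot(k+1)},\qquad \boldsymbol d_k=(\boldsymbol b\odot\boldsymbol c^{\odot k})\times^1\mathbf A-\tfrac1{k+1}\,\boldsymbol b\odot(\boldsymbol 1-\boldsymbol c^{\odot(k+1)}).$$ The $Q$-type and $D$-type spaces are the subspaces of $\mathbb R^s$ defined recursively by $Q_1=\operatorname{span}\{\boldsymbol q_0\}$, $D_1=\operatorname{span}\{\boldsymbol d_0\}$ and, for $k\ge2$, $$Q_k=\operatorname{span}\big(Q_{k-1}\cup\{\boldsymbol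 q_{k-1}\}\cup \mathbf AQ_{k-1}\cup (Q_{k-1}\odot\boldsymbol c)\big),$$ $$D_k=\operatorname{span}\big(D_{k-1}\cup\{\boldsymbol d_{k-1}\}\cup (D_{k-1}\times^1\mathbf A)\cup(D_{k-1}\odot\boldsymbol c)\big).$$ In the definition of $W_n$ the indices $l_1,l_2$ are positive integers. For a rooted tree $t$, $|t|$ is its number of vertices. If $t=[t_1,\dots,t_r]$ is obtained by grafting trees $t_1,\dots,t_r$ onto a new root, the elementary weight vector is $\boldsymbol\Phi(t)=\bigodot_{j=1}^r \mathbf A\boldsymbol\Phi(t_j)$, with $\boldsymbol\Phi(t)=\boldsymbol1$ for the single-vertex tree. The tree factorial (density) is $\gamma(t)=|t|\prod_{j=1}^r\gamma(t_j)$, with $\gamma=1$ for the single-vertex tree. The method has order at least $p$ if the order conditions $\boldsymbol b\cdot\boldsymbol\Phi(t)=1/\gamma(t)$ hold for every rooted tree $t$ with $1\le|t|\le p$. *)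

theory Defs
  imports "HOL-Analysis.Analysis" "HOL-Library.Multiset"
begin

text \<open>
  Stages are indexed by a finite linearly ordered type \<open>'s\<close>, so \<open>s = CARD('s)\<close>.
  On \<open>real ^ 's\<close> the ring operations \<open>*\<close>, \<open>^\<close> and \<open>1\<close> are entrywise, i.e. they are
  the Hadamard product, the Hadamard power and the all-ones vector. The product \<open>d v* A\<close>
  is the row vector \<open>d\<close> times \<open>A\<close>.
\<close>

definition explicit_RK ::
  "real ^ ('s :: {finite, linorder}) ^ ('s :: {finite, linorder}) \<Rightarrow> real ^ ('s :: {finite, linorder}) \<Rightarrow> real ^ ('s :: {finite, linorder}) \<Rightarrow> bool" where
  "explicit_RK A b c \<longleftrightarrow> (\<forall>i j. i \<le> j \<longrightarrow> A $ i $ j = 0)"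

definition qvec :: "real ^ 's ^ 's \<Rightarrow> real ^ 's \<Rightarrow> nat \<Rightarrow> real ^ 's" where
  "qvec A c k = A *v c ^ k - (1 / real (k + 1)) *\<^sub>R c ^ (k + 1)"

definition dvec :: "real ^ 's ^ 's \<Rightarrow> real ^ 's \<Rightarrow> real ^ 's \<Rightarrow> nat \<Rightarrow> real ^ 's" where
  "dvec A b c k = (b * c ^ k) v* A - (1 / real (k + 1)) *\<^sub>R (b * (1 - c ^ (k + 1)))"

text \<open>
  The spaces are defined for positive indices; the value at index \<open>0\<close> is a dummy.
\<close>

fun Qspace :: "real ^ 's ^ 's \<Rightarrow> real ^ 's \<Rightarrow> nat \<Rightarrow> (real ^ 's) set" where
  "Qspace A c 0 = {0}"
| "Qspace A c (Suc 0) = span {qvec A c 0}"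
| "Qspace A c (Suc (Suc k)) =
     span (Qspace A c (Suc k) \<union> {qvec A c (Suc k)}
           \<union> (\<lambda>q. A *v q) ` Qspace A c (Suc k) \<union> (\<lambda>q. q * c) ` Qspace A c (Suc k))"

fun Dspace :: "real ^ 's ^ 's \<Rightarrow> real ^ 's \<Rightarrow> real ^ 's \<Rightarrow> nat \<Rightarrow> (real ^ 's) set" where
  "Dspace A b c 0 = {0}"
| "Dspace A b c (Suc 0) = span {dvec A b c 0}"
| "Dspace A b c (Suc (Suc k)) =
     span (Dspace A b c (Suc k) \<union> {dvec A b c (Suc k)}
           \<union> (\<lambda>d. d v* A) ` Dspace A b c (Suc k) \<union> (\<lambda>d. d * c) ` Dspace A b c (Suc k))"

definition Wset :: "real ^ 's ^ 's \<Rightarrow> real ^ 's \<Rightarrow> real ^ 's \<Rightarrow> nat \<Rightarrow> (real ^ 's) set" where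
  "Wset A b c n =
     {(q * d) v* A - q * (d v* A) | q d l1 l2.
        1 \<le> l1 \<and> 1 \<le> l2 \<and> l1 + l2 \<le> n - 1 \<and> q \<in> Qspace A c l1 \<and> d \<in> Dspace A b c l2}"

text \<open>
  \<open>Node {#t\<^sub>1, \<dots>, t\<^sub>r#}\<close> is \<open>[t\<^sub>1, \<dots>, t\<^sub>r]\<close>; multisets of subtrees
  give unordered rooted trees, and \<open>Node {#}\<close> is the single vertex.
\<close>

datatype rtree = Node "rtree multiset"

primrec num_vertices :: "rtree \<Rightarrow> nat" where
  "num_vertices (Node ts) = Suc (\<Sum>\<^sub># (image_mset num_vertices ts))"

primrec tree_factorial :: "rtree \<Rightarrow> nat" where
  "tree_factorial (Node ts) = num_vertices (Node ts) * \<Prod>\<^sub># (image_mset tree_factorial ts)"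

primrec elem_weight :: "real ^ 's ^ 's \<Rightarrow> rtree \<Rightarrow> real ^ 's" where
  "elem_weight A (Node ts) = \<Prod>\<^sub># (image_mset (\<lambda>t. A *v elem_weight A t) ts)"

definition RK_order_at_least :: "real ^ 's ^ 's \<Rightarrow> real ^ 's \<Rightarrow> nat \<Rightarrow> bool" where
  "RK_order_at_least A b p \<longleftrightarrow>
     (\<forall>t. 1 \<le> num_vertices t \<and> num_vertices t \<le> p \<longrightarrow>
        b \<bullet> elem_weight A t = 1 / real (tree_factorial t))"

definition cond_B :: "real ^ 's \<Rightarrow> real ^ 's \<Rightarrow> nat \<Rightarrow> bool" where
  "cond_B b c p \<longleftrightarrow> (\<forall>k. 1 \<le> k \<and> k \<le> p \<longrightarrow> b \<bullet> c ^ (k - 1) = 1 / real k)"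

definition cond_QO :: "real ^ 's ^ 's \<Rightarrow> real ^ 's \<Rightarrow> real ^ 's \<Rightarrow> nat \<Rightarrow> bool" where
  "cond_QO A b c m \<longleftrightarrow> (\<forall>q \<in> Qspace A c m. b * q = 0)"

definition cond_DO :: "real ^ 's ^ 's \<Rightarrow> real ^ 's \<Rightarrow> real ^ 's \<Rightarrow> nat \<Rightarrow> nat \<Rightarrow> bool" where
  "cond_DO A b c p n \<longleftrightarrow>
     (\<forall>d \<in> Dspace A b c n. \<forall>k. 1 \<le> k \<and> k + n \<le> p \<longrightarrow> d \<bullet> c ^ (k - 1) = 0)"

definition cond_QD_weak :: "real ^ 's ^ 's \<Rightarrow> real ^ 's \<Rightarrow> real ^ 's \<Rightarrow> nat \<Rightarrow> nat \<Rightarrow> bool" where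
  "cond_QD_weak A b c m n \<longleftrightarrow> (\<forall>q \<in> Qspace A c m. \<forall>d \<in> Dspace A b c n. q \<bullet> d = 0)"

definition cond_PR :: "real ^ 's ^ 's \<Rightarrow> real ^ 's \<Rightarrow> real ^ 's \<Rightarrow> nat \<Rightarrow> nat \<Rightarrow> nat \<Rightarrow> bool" where
  "cond_PR A b c p m n \<longleftrightarrow>
     (\<forall>w \<in> Wset A b c n. \<forall>t. m + 1 \<le> num_vertices t \<and> num_vertices t + 3 \<le> p \<longrightarrow>
        w \<bullet> elem_weight A t = 0)"

definition cond_QR :: "real ^ 's ^ 's \<Rightarrow> real ^ 's \<Rightarrow> nat \<Rightarrow> bool" where
  "cond_QR A c m \<longleftrightarrow>
     (\<forall>m1 m2. 1 \<le> m2 \<and> m2 \<le> m1 \<and> m1 \<le> m \<longrightarrow>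
        (\<forall>q \<in> Qspace A c m1. \<forall>q' \<in> Qspace A c m2. q * q' \<in> Qspace A c m1))"

end

theory Submission
  imports Defs
begin

text \<open>
  A tree whose branches all have at most \<open>m\<close> vertices has
  \<open>\<Phi>(t) = |t|/\<gamma>(t) c\<^bsup>|t|-1\<^esup>\<close> up to products of powers of \<open>c\<close> with elements
  of the \<open>Q\<close>-type spaces; such products are annihilated by \<open>b\<close>, and, after moving powers of
  \<open>c\<close> from one factor to the other, by the \<open>D\<close>-type spaces. Since
  \<open>p \<le> m + n + 1\<close> and \<open>n - 1 \<le> m\<close>, any other tree with at most \<open>p\<close> vertices
  has exactly one branch \<open>t'\<close> with more than \<open>m\<close> vertices, and the remaining
  branches have at most \<open>n - 1\<close> vertices in total. In a pairing with \<open>A \<Phi>(t')\<close> the matrix is moved to the other side: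
  \<open>b c\<^sup>k\<close> produces \<open>d\<^sub>k\<close>, \<open>D\<close>-type vectors produce
  \<open>D\<close>-type vectors of higher index, and the products \<open>q d\<close> are handled by \<open>PR(n)\<close>. Carrying an
  additional factor \<open>c\<^sup>k\<close> makes this an induction on the tree.
\<close>

section \<open>Entrywise products, vertex counts and densities\<close>

lemma inner_times_vec: "x \<bullet> (y * z) = (x * y) \<bullet> (z :: real ^ 's)"
  by (simp add: inner_vec_def mult.assoc)

lemma scaleR_times_vec:
  fixes x y :: "real ^ 's"
  shows "(r *\<^sub>R x) * y = r *\<^sub>R (x * y)" and "x * (r *\<^sub>R y) = r *\<^sub>R (x * y)"
  by (simp_all add: vec_eq_iff)

lemma num_vertices_pos: "num_vertices t > 0"
  by (cases t) simp

lemma tree_factorial_pos: "tree_factorial t > 0"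
proof (induction t)
  case (Node ts)
  then have "0 \<notin># image_mset tree_factorial ts" by force
  then have "\<Prod>\<^sub># (image_mset tree_factorial ts) > 0"
    by (metis gr0I prod_mset_zero_iff)
  then show ?case by simp
qed

lemma num_vertices_div_tree_factorial:
  "real (num_vertices (Node ts)) / real (tree_factorial (Node ts))
     = 1 / real (\<Prod>\<^sub># (image_mset tree_factorial ts))"
  using num_vertices_pos[of "Node ts"] unfolding tree_factorial.simps of_nat_mult
  by (simp del: num_vertices.simps)

lemma num_vertices_branch:
  "t \<in># ts \<Longrightarrow> num_vertices t \<le> (\<Sum>\<^sub># (image_mset num_vertices ts))"
  by (auto dest!: multi_member_split)

section \<open>Monotonicity and closure of the Q-type and D-type spaces\<close>

lemma subspace_Qspace: "subspace (Qspace A c k)"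
  by (induction A c k rule: Qspace.induct) (auto simp: subspace_span)

lemma Qspace_Suc: "Qspace A c k \<subseteq> Qspace A c (Suc k)"
  by (cases k) (auto intro: span_base span_0)

lemma Qspace_mono: "k \<le> l \<Longrightarrow> Qspace A c k \<subseteq> Qspace A c l"
  by (rule lift_Suc_mono_le[of "Qspace A c"]) (auto intro: Qspace_Suc[THEN subsetD])

lemma Qspace_qvec: "qvec A c k \<in> Qspace A c (Suc k)"
  by (cases k) (auto intro: span_base)

lemma Qspace_matrix: "q \<in> Qspace A c k \<Longrightarrow> A *v q \<in> Qspace A c (Suc k)"
  by (cases k) (auto intro: span_base span_0)

lemma Qspace_times: "q \<in> Qspace A c k \<Longrightarrow> q * c ^ e \<in> Qspace A c (k + e)"
proof (induction e)
  case (Suc e)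
  have "x * c \<in> Qspace A c (Suc l)" if "x \<in> Qspace A c l" for x l
    using that by (cases l) (auto intro: span_base span_0)
  from this[OF Suc.IH[OF Suc.prems]] show ?case by (simp add: ac_simps)
qed simp

lemma Dspace_dvec: "dvec A b c k \<in> Dspace A b c (Suc k)"
  by (cases k) (auto intro: span_base)

lemma Dspace_Suc: "Dspace A b c k \<subseteq> Dspace A b c (Suc k)"
  by (cases k) (auto intro: span_base span_0)

lemma Dspace_mono: "k \<le> l \<Longrightarrow> Dspace A b c k \<subseteq> Dspace A b c l"
  by (rule lift_Suc_mono_le[of "Dspace A b c"]) (auto intro: Dspace_Suc[THEN subsetD])

lemma Dspace_matrix: "d \<in> Dspace A b c k \<Longrightarrow> d v* A \<in> Dspace A b c (Suc k)"
  by (cases k) (auto intro: span_base span_0)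

lemma Dspace_times: "d \<in> Dspace A b c k \<Longrightarrow> d * c ^ e \<in> Dspace A b c (k + e)"
proof (induction e)
  case (Suc e)
  have "x * c \<in> Dspace A b c (Suc l)" if "x \<in> Dspace A b c l" for x l
    using that by (cases l) (auto intro: span_base span_0)
  from this[OF Suc.IH[OF Suc.prems]] show ?case by (simp add: ac_simps)
qed simp

section \<open>Congruence to powers of \<open>c\<close> modulo Q-type errors\<close>

text \<open>\<open>N\<close> bounds a degree in which \<open>c\<close> counts 1 and
  \<open>Qspace A c a\<close> counts \<open>a\<close>. Capping \<open>a\<close> at \<open>m\<close>
  keeps \<open>QO(m)\<close> and \<open>QR(m)\<close> applicable to the Q-factor even when
  \<open>N\<close> exceeds \<open>m\<close>.\<close>

definition Qhat :: "real ^ 's ^ 's \<Rightarrow> real ^ 's \<Rightarrow> nat \<Rightarrow> nat \<Rightarrow> (real ^ 's) set" where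
  "Qhat A c m N = span {c ^ e * q | e q a. 1 \<le> a \<and> a \<le> m \<and> a + e \<le> N \<and> q \<in> Qspace A c a}"

definition congQ :: "real ^ 's ^ 's \<Rightarrow> real ^ 's \<Rightarrow> nat \<Rightarrow> nat \<Rightarrow> real ^ 's \<Rightarrow> real \<Rightarrow> bool" where
  "congQ A c m N x \<alpha> \<longleftrightarrow> x - \<alpha> *\<^sub>R c ^ N \<in> Qhat A c m N"

lemma subspace_Qhat: "subspace (Qhat A c m N)"
  by (simp add: Qhat_def subspace_span)

lemma Qspace_subset_Qhat:
  assumes "k \<le> m" shows "Qspace A c k \<subseteq> Qhat A c m k"
proof (cases k)
  \<comment> \<open>The dummy space at index 0 is \<open>{0}\<close>, while generators of
    \<open>Qhat\<close> need \<open>1 \<le> a\<close>.\<close>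
  case 0
  then show ?thesis by (simp add: subspace_0[OF subspace_Qhat])
next
  case (Suc j)
  show ?thesis
  proof
    fix q assume "q \<in> Qspace A c k"
    then have "c ^ 0 * q \<in> Qhat A c m k"
      unfolding Qhat_def using Suc assms by (intro span_base) force
    then show "q \<in> Qhat A c m k" by simp
  qed
qed

lemma Qhat_subset_Qspace: "Qhat A c m N \<subseteq> Qspace A c N"
  unfolding Qhat_def
proof (rule span_minimal[OF _ subspace_Qspace], safe)
  fix e q a assume "a + e \<le> N" "q \<in> Qspace A c a"
  then show "c ^ e * q \<in> Qspace A c N"
    using Qspace_times[of q A c a e] Qspace_mono[of "a + e" N A c]
    by (auto simp: mult.commute)
qed

lemma Qhat_times_power:
  assumes "x \<in> Qhat A c m N" shows "c ^ M * x \<in> Qhat A c m (N + M)"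
  using assms unfolding Qhat_def
proof (induction rule: span_induct_alt)
  case base
  then show ?case by (simp add: span_0)
next
  case (step r x y)
  then obtain e q a where x: "x = c ^ e * q" "1 \<le> a" "a \<le> m" "a + e \<le> N" "q \<in> Qspace A c a"
    by blast
  have "c ^ M * x = c ^ (M + e) * q" by (simp add: x power_add mult.assoc)
  with x have "c ^ M * x \<in> span {c ^ e * q | e q a. 1 \<le> a \<and> a \<le> m \<and> a + e \<le> N + M \<and> q \<in> Qspace A c a}"
    by (intro span_base CollectI exI[of _ "M + e"] exI[of _ q] exI[of _ a]) auto
  with step show ?case
    by (auto simp: distrib_left scaleR_times_vec intro: span_add span_scale)
qed

text \<open>On generators the powers of \<open>c\<close> multiply, and \<open>QR(m)\<close> puts the
  product of the Q-factors into the space of the larger index, which still respects the cap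
  \<open>m\<close>. Two span inductions extend this bilinearly.\<close>

lemma Qhat_times:
  assumes QR: "cond_QR A c m" and "x \<in> Qhat A c m N" and "y \<in> Qhat A c m M"
  shows "x * y \<in> Qhat A c m (N + M)"
proof -
  have gen: "c ^ e * q * y \<in> Qhat A c m (N + M)"
    if "1 \<le> a" "a \<le> m" "a + e \<le> N" "q \<in> Qspace A c a" for e q a
    using assms(3) unfolding Qhat_def
  proof (induction rule: span_induct_alt)
    case base
    then show ?case by (simp add: span_0)
  next
    case (step r y z)
    then obtain f q' a' where y: "y = c ^ f * q'" "1 \<le> a'" "a' \<le> m" "a' + f \<le> M" "q' \<in> Qspace A c a'"
      by blast
    have "q * q' \<in> Qspace A c (max a a')"
      using QR that y unfolding cond_QR_def
      by (cases "a' \<le> a") (simp_all add: max_def, metis mult.commute nat_le_linear)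
    moreover have "c ^ e * q * y = c ^ (e + f) * (q * q')"
      by (simp add: y power_add ac_simps)
    ultimately have "c ^ e * q * y \<in> span {c ^ e * q | e q a. 1 \<le> a \<and> a \<le> m \<and> a + e \<le> N + M \<and> q \<in> Qspace A c a}"
      using that y
      by (intro span_base CollectI exI[of _ "e + f"] exI[of _ "q * q'"] exI[of _ "max a a'"]) auto
    with step show ?case
      by (auto simp: distrib_left scaleR_times_vec intro: span_add span_scale)
  qed
  show ?thesis
    using assms(2) unfolding Qhat_def[of A c m N]
  proof (induction rule: span_induct_alt)
    case base
    then show ?case by (simp add: subspace_0[OF subspace_Qhat])
  next
    case (step r x z)
    then have "x * y \<in> Qhat A c m (N + M)" using gen by blast
    with step show ?case
      by (auto simp: distrib_right scaleR_times_vec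
          intro: subspace_add[OF subspace_Qhat] subspace_scale[OF subspace_Qhat])
  qed
qed

lemma congQ_one: "congQ A c m 0 1 1"
  by (simp add: congQ_def subspace_0[OF subspace_Qhat])

lemma congQ_times:
  assumes "cond_QR A c m" "congQ A c m N x \<alpha>" "congQ A c m M y \<beta>"
  shows "congQ A c m (N + M) (x * y) (\<alpha> * \<beta>)"
proof -
  define u where "u = x - \<alpha> *\<^sub>R c ^ N"
  define v where "v = y - \<beta> *\<^sub>R c ^ M"
  have u: "u \<in> Qhat A c m N" and v: "v \<in> Qhat A c m M"
    using assms by (simp_all add: congQ_def u_def v_def)
  have "c ^ N * v \<in> Qhat A c m (N + M)" "c ^ M * u \<in> Qhat A c m (N + M)" "u * v \<in> Qhat A c m (N + M)"
    using Qhat_times_power[OF v, of N] Qhat_times_power[OF u, of M] Qhat_times[OF assms(1) u v]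
    by (simp_all add: add.commute)
  then have "\<alpha> *\<^sub>R (c ^ N * v) + \<beta> *\<^sub>R (c ^ M * u) + u * v \<in> Qhat A c m (N + M)"
    by (intro subspace_add subspace_scale subspace_Qhat)
  moreover have "x * y - (\<alpha> * \<beta>) *\<^sub>R c ^ (N + M) = \<alpha> *\<^sub>R (c ^ N * v) + \<beta> *\<^sub>R (c ^ M * u) + u * v"
    by (simp add: u_def v_def vec_eq_iff power_add algebra_simps)
  ultimately show ?thesis by (simp add: congQ_def)
qed

lemma congQ_prod_mset:
  assumes "cond_QR A c m" "\<And>t. t \<in># ts \<Longrightarrow> congQ A c m (f t) (x t) (1 / real (g t))"
  shows "congQ A c m (\<Sum>\<^sub># (image_mset f ts)) (\<Prod>\<^sub># (image_mset x ts))
           (1 / real (\<Prod>\<^sub># (image_mset g ts)))"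
  using assms(2)
proof (induction ts)
  case empty
  then show ?case by (simp add: congQ_one)
next
  case (add t ts)
  then have "congQ A c m (f t) (x t) (1 / real (g t))" by simp
  from congQ_times[OF assms(1) this add.IH] add.prems show ?case by simp
qed

section \<open>Elementary weights modulo \<open>Qhat\<close>\<close>

text \<open>Applying \<open>A\<close> sends the error into the next Q-type space, and
  \<open>A *v c ^ N\<close> differs from \<open>c ^ (N + 1) / (N + 1)\<close> by
  \<open>qvec A c N\<close>. The return from \<open>Qspace\<close> to \<open>Qhat\<close> uses
  \<open>num_vertices t \<le> m\<close>.\<close>

lemma congQ_elem_weight:
  assumes QR: "cond_QR A c m" and "num_vertices t \<le> m"
  shows "congQ A c m (num_vertices t) (A *v elem_weight A t) (1 / real (tree_factorial t))"
  using assms(2)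
proof (induction t)
  case (Node ts)
  let ?N = "\<Sum>\<^sub># (image_mset num_vertices ts)"
  define \<beta> where "\<beta> = 1 / real (\<Prod>\<^sub># (image_mset tree_factorial ts))"
  have "num_vertices t \<le> m" if "t \<in># ts" for t
    using num_vertices_branch[OF that] Node.prems by simp
  then have "congQ A c m ?N (elem_weight A (Node ts)) \<beta>"
    unfolding \<beta>_def elem_weight.simps by (intro congQ_prod_mset[OF QR] Node.IH)
  then have "A *v (elem_weight A (Node ts) - \<beta> *\<^sub>R c ^ ?N) \<in> Qspace A c (Suc ?N)"
    unfolding congQ_def using Qhat_subset_Qspace Qspace_matrix by blast
  moreover have "A *v elem_weight A (Node ts) - (\<beta> / real (Suc ?N)) *\<^sub>R c ^ Suc ?N
      = A *v (elem_weight A (Node ts) - \<beta> *\<^sub>R c ^ ?N) + \<beta> *\<^sub>R qvec A c ?N"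
    by (simp add: qvec_def matrix_vector_mult_diff_distrib matrix_vector_mult_scaleR algebra_simps)
  ultimately have "A *v elem_weight A (Node ts) - (\<beta> / real (Suc ?N)) *\<^sub>R c ^ Suc ?N \<in> Qspace A c (Suc ?N)"
    by (simp add: subspace_add subspace_scale subspace_Qspace Qspace_qvec)
  then have "congQ A c m (Suc ?N) (A *v elem_weight A (Node ts)) (\<beta> / real (Suc ?N))"
    unfolding congQ_def using subsetD[OF Qspace_subset_Qhat] Node.prems
    by (metis num_vertices.simps)
  then show ?case by (simp only: \<beta>_def num_vertices.simps tree_factorial.simps of_nat_mult
        divide_divide_eq_left mult.commute)
qed

text \<open>
  In the second case \<open>\<beta>\<close> is \<open>1\<close> over the product of the densities of the
  branches other than \<open>t'\<close>; the last equation avoids naming this product.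
\<close>

lemma elem_weight_cases:
  assumes QR: "cond_QR A c m" and "n - 1 \<le> m" "1 \<le> n" "p \<le> m + n + 1"
    and "num_vertices (Node ts) \<le> p"
  obtains
    (small) "congQ A c m (num_vertices (Node ts) - 1) (elem_weight A (Node ts))
               (real (num_vertices (Node ts)) / real (tree_factorial (Node ts)))"
  | (large) t' u y \<beta> where
      "t' \<in># ts" "m + 1 \<le> num_vertices t'" "num_vertices (Node ts) = num_vertices t' + u + 1"
      "u \<le> n - 1" "congQ A c m u y \<beta>" "elem_weight A (Node ts) = y * (A *v elem_weight A t')"
      "\<beta> / real (tree_factorial t') = real (num_vertices (Node ts)) / real (tree_factorial (Node ts))"
proof (cases "\<forall>t \<in># ts. num_vertices t \<le> m")
  case True
  then show ?thesis
    using congQ_prod_mset[OF QR congQ_elem_weight[OF QR], of ts "\<lambda>t. t"]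
    unfolding multiset.map_ident
    by (intro small, unfold num_vertices_div_tree_factorial) simp
next
  case False
  then obtain t' where t': "t' \<in># ts" "m + 1 \<le> num_vertices t'" by force
  then obtain rest where ts: "ts = add_mset t' rest" by (meson multi_member_split)
  let ?u = "\<Sum>\<^sub># (image_mset num_vertices rest)"
  \<comment> \<open>From \<open>m + 1 + ?u + 1 \<le> p \<le> m + n + 1\<close>. As
    \<open>n - 1 \<le> m\<close>, all branches in \<open>rest\<close> are then small.\<close>
  have u: "?u \<le> n - 1" using assms(3-5) t' by (simp add: ts)
  have "num_vertices t \<le> m" if "t \<in># rest" for t
    using num_vertices_branch[OF that] u assms(2) by simp
  then have "congQ A c m ?u (\<Prod>\<^sub># (image_mset (\<lambda>t. A *v elem_weight A t) rest))
               (1 / real (\<Prod>\<^sub># (image_mset tree_factorial rest)))"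
    by (intro congQ_prod_mset[OF QR] congQ_elem_weight[OF QR])
  then show ?thesis
    using t' u
  proof (intro large)
    show "elem_weight A (Node ts) = (\<Prod>t\<in>#rest. A *v elem_weight A t) * (A *v elem_weight A t')"
      by (simp add: ts mult.commute)
    show "1 / real (\<Prod>\<^sub># (image_mset tree_factorial rest)) / real (tree_factorial t')
        = real (num_vertices (Node ts)) / real (tree_factorial (Node ts))"
      unfolding num_vertices_div_tree_factorial ts by simp
  qed (simp_all add: ts)
qed

section \<open>Pairings of \<open>b\<close> and of D-type vectors with Q-type errors, powers and
  weights\<close>

locale simplified_RK =
  fixes A :: "real ^ 's ^ 's" and b c :: "real ^ 's" and p m n :: nat
  assumes n_pos: "1 \<le> n" and n_le: "n - 1 \<le> m" and p_le: "p \<le> m + n + 1"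
    and B: "cond_B b c p" and QO: "cond_QO A b c m" and DO: "cond_DO A b c p n"
    and QD: "cond_QD_weak A b c m n" and PR: "cond_PR A b c p m n" and QR: "cond_QR A c m"
begin

lemma b_times_Qhat:
  assumes "x \<in> Qhat A c m N" shows "b * x = 0"
  using assms unfolding Qhat_def
proof (induction rule: span_induct_alt)
  case (step r x y)
  then obtain e q a where x: "x = c ^ e * q" "a \<le> m" "q \<in> Qspace A c a"
    by blast
  then have "b * q = 0" using QO Qspace_mono[of a m A c] unfolding cond_QO_def by blast
  then have "b * x = 0" by (metis x(1) mult.left_commute mult_zero_right)
  with step show ?case by (simp add: distrib_left scaleR_times_vec)
qed simp

lemma b_times_congQ: "congQ A c m N x \<alpha> \<Longrightarrow> b * x = \<alpha> *\<^sub>R (b * c ^ N)"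
  using b_times_Qhat[of "x - \<alpha> *\<^sub>R c ^ N" N]
  by (simp add: congQ_def right_diff_distrib scaleR_times_vec)

text \<open>Powers of \<open>c\<close> are divided between \<open>d\<close> and \<open>q\<close> so
  that the indices stay within \<open>n\<close> and \<open>m\<close>; then
  \<open>QD_weak(m,n)\<close> applies.\<close>

lemma Dspace_inner_Qhat:
  assumes "d \<in> Dspace A b c l" "l \<le> n" "l + N \<le> m + n" "x \<in> Qhat A c m N"
  shows "d \<bullet> x = 0"
  using assms(4) unfolding Qhat_def
proof (induction rule: span_induct_alt)
  case (step r x y)
  then obtain e q a where x: "x = c ^ e * q" "a \<le> m" "a + e \<le> N" "q \<in> Qspace A c a"
    by blast
  \<comment> \<open>\<open>d\<close> absorbs as many powers as index \<open>n\<close> allows. If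
    some remain, \<open>l + f = n\<close> and \<open>l + N \<le> m + n\<close> bounds the index left
    on the Q-side; otherwise \<open>a \<le> m\<close> suffices.\<close>
  define f where "f = min e (n - l)"
  have f: "f \<le> e" "l + f \<le> n" "a + (e - f) \<le> m"
    using assms x by (auto simp: f_def min_def)
  have "d * c ^ f \<in> Dspace A b c n"
    using Dspace_times[OF assms(1)] Dspace_mono[OF f(2)] by blast
  moreover have "q * c ^ (e - f) \<in> Qspace A c m"
    using Qspace_times[OF x(4)] Qspace_mono[OF f(3)] by blast
  ultimately have "(d * c ^ f) \<bullet> (q * c ^ (e - f)) = 0"
    using QD unfolding cond_QD_weak_def by (subst inner_commute) blast
  moreover have "x = c ^ f * (q * c ^ (e - f))"
    using f(1) by (simp add: x mult.left_commute mult.commute flip: power_add)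
  ultimately have "d \<bullet> x = 0" by (simp add: inner_times_vec)
  with step show ?case by (simp add: inner_add_right)
qed simp

text \<open>The same shift, ending in \<open>DO(n)\<close>. If \<open>d\<close> absorbs the whole
  power, exponent 0 remains, and \<open>n < p\<close> admits it.\<close>

lemma Dspace_inner_power:
  assumes "d \<in> Dspace A b c l" "l \<le> n" "n < p" "l + e < p"
  shows "d \<bullet> c ^ e = 0"
proof -
  define f where "f = min e (n - l)"
  have f: "f \<le> e" "l + f \<le> n" "Suc (e - f) + n \<le> p"
    using assms by (auto simp: f_def min_def)
  have "d * c ^ f \<in> Dspace A b c n"
    using Dspace_times[OF assms(1)] Dspace_mono[OF f(2)] by blast
  then have "(d * c ^ f) \<bullet> c ^ (Suc (e - f) - 1) = 0"
    using DO f(3) unfolding cond_DO_def by (metis One_nat_def Suc_le_mono le0)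
  then show ?thesis
    using f(1) by (simp flip: inner_times_vec power_add)
qed

text \<open>Descending to the large branch preserves \<open>num_vertices t + l + s\<close>: the lost
  root raises \<open>l\<close> by one through \<open>d v* A\<close>, and the \<open>u\<close> lost
  vertices raise \<open>s\<close> through \<open>q * y\<close>.\<close>

lemma Dspace_Qspace_inner_elem_weight:
  assumes "d \<in> Dspace A b c l" "q \<in> Qspace A c s" "1 \<le> l" "1 \<le> s" "l + s \<le> n"
    and "num_vertices t + l + s \<le> p"
  shows "(d * q) \<bullet> elem_weight A t = 0"
  using assms
proof (induction t arbitrary: d q l s)
  case (Node ts)
  \<comment> \<open>Coefficient 0 expresses membership in \<open>Qhat\<close>;
    \<open>l \<ge> 1\<close> gives \<open>s \<le> n - 1 \<le> m\<close>.\<close>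
  have q: "congQ A c m s q 0"
    using subsetD[OF Qspace_subset_Qhat[of s m A c], of q] Node.prems n_le by (simp add: congQ_def)
  have "num_vertices (Node ts) \<le> p" using Node.prems by simp
  from QR n_le n_pos p_le this show ?case
  proof (cases rule: elem_weight_cases)
    case small
    let ?N = "s + (num_vertices (Node ts) - 1)"
    have "q * elem_weight A (Node ts) \<in> Qhat A c m ?N"
      using congQ_times[OF QR q small] by (simp add: congQ_def)
    then have "d \<bullet> (q * elem_weight A (Node ts)) = 0"
      using Node.prems p_le by (intro Dspace_inner_Qhat[where N = ?N and l = l]) auto
    then show ?thesis by (simp only: inner_times_vec)
  next
    case (large t' u y \<beta>)
    have "q * y \<in> Qhat A c m (s + u)"
      using congQ_times[OF QR q large(5)] by (simp add: congQ_def)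
    then have qy: "q * y \<in> Qspace A c (s + u)" using Qhat_subset_Qspace by blast
    have bounds: "l + (s + u) \<le> n - 1" "num_vertices t' + 3 \<le> p"
      using Node.prems large(2,3) p_le by linarith+
    then have "(q * y * d) v* A - q * y * (d v* A) \<in> Wset A b c n"
      using Node.prems qy unfolding Wset_def
      by (intro CollectI exI[of _ "q * y"] exI[of _ d] exI[of _ l] exI[of _ "s + u"]) auto
    then have "((q * y * d) v* A - q * y * (d v* A)) \<bullet> elem_weight A t' = 0"
      using PR large(2) bounds unfolding cond_PR_def by blast
    moreover have "(d v* A * (q * y)) \<bullet> elem_weight A t' = 0"
      using Node.prems bounds large qy
      by (intro Node.IH[OF large(1) Dspace_matrix[of d A b c l] qy]) auto
    ultimately have "(q * y * d) \<bullet> (A *v elem_weight A t') = 0"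
      by (simp add: inner_diff_left dot_lmul_matrix mult.commute)
    then show ?thesis
      by (simp add: large(6) inner_times_vec ac_simps del: elem_weight.simps)
  qed
qed

text \<open>At a large branch the other factor splits as \<open>\<beta> *\<^sub>R c ^ u + q\<close>:
  the power is absorbed by \<open>d\<close> and left to the induction, while \<open>q\<close> is
  handled by \<open>PR(n)\<close> and the preceding lemma.\<close>

lemma Dspace_inner_elem_weight:
  assumes "d \<in> Dspace A b c l" "1 \<le> l" "l \<le> n" "n < p" "num_vertices t + l \<le> p"
  shows "d \<bullet> elem_weight A t = 0"
  using assms
proof (induction t arbitrary: d l)
  case (Node ts)
  have "num_vertices (Node ts) \<le> p" using Node.prems by simp
  from QR n_le n_pos p_le this show ?case
  proof (cases rule: elem_weight_cases)
    case small
    let ?N = "num_vertices (Node ts) - 1"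
    have "d \<bullet> (elem_weight A (Node ts)
              - (real (num_vertices (Node ts)) / real (tree_factorial (Node ts))) *\<^sub>R c ^ ?N) = 0"
      using Node.prems p_le small
      by (intro Dspace_inner_Qhat[where N = ?N and l = l]) (auto simp: congQ_def)
    moreover have "d \<bullet> c ^ ?N = 0"
      using Node.prems by (intro Dspace_inner_power[of d l]) auto
    ultimately show ?thesis by (simp add: inner_diff_right)
  next
    case (large t' u y \<beta>)
    define q where "q = y - \<beta> *\<^sub>R c ^ u"
    have q: "q \<in> Qspace A c u"
      using subsetD[OF Qhat_subset_Qspace] large(5) unfolding congQ_def q_def by blast
    have bounds: "l + u \<le> n - 1" using Node.prems large(2,3) p_le by linarith
    have "((d * c ^ u) v* A) \<bullet> elem_weight A t' = 0"
      using Node.prems bounds large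
      by (intro Node.IH[OF large(1) Dspace_matrix[OF Dspace_times[of d A b c l u]]]) auto
    moreover have "(d * q) \<bullet> (A *v elem_weight A t') = 0"
    \<comment> \<open>\<open>Wset\<close> requires positive indices, and the size bound in
      \<open>PR(n)\<close> also uses \<open>u \<ge> 1\<close>. For \<open>u = 0\<close> the dummy
      space forces \<open>q = 0\<close>.\<close>
    proof (cases "u = 0")
      case True
      then show ?thesis using q by simp
    next
      case False
      have "num_vertices t' + 3 \<le> p" using Node.prems large(3) False by linarith
      moreover have "(q * d) v* A - q * (d v* A) \<in> Wset A b c n"
        using Node.prems q False bounds unfolding Wset_def
        by (intro CollectI exI[of _ q] exI[of _ d] exI[of _ l] exI[of _ u]) auto
      ultimately have "((q * d) v* A - q * (d v* A)) \<bullet> elem_weight A t' = 0"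
        using PR large(2) unfolding cond_PR_def by blast
      moreover have "(d v* A * q) \<bullet> elem_weight A t' = 0"
        using Node.prems bounds large q False
        by (intro Dspace_Qspace_inner_elem_weight[OF Dspace_matrix[of d A b c l] q]) auto
      ultimately show ?thesis
        by (simp add: inner_diff_left dot_lmul_matrix mult.commute)
    qed
    moreover have "y = \<beta> *\<^sub>R c ^ u + q" by (simp add: q_def)
    ultimately show ?thesis
      by (simp add: large(6) inner_times_vec distrib_left scaleR_times_vec inner_add_left
          dot_lmul_matrix del: elem_weight.simps)
  qed
qed

section \<open>The order conditions\<close>

text \<open>The value is the reciprocal density of \<open>t\<close> with \<open>k\<close> extra
  leaves grafted onto its root. General \<open>k\<close> is needed because the defining relation of
  \<open>dvec\<close> brings powers of \<open>c\<close> into the induction.\<close>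

lemma b_inner_power_elem_weight:
  assumes "num_vertices t + k \<le> p"
  shows "b \<bullet> (c ^ k * elem_weight A t)
           = real (num_vertices t) / (real (tree_factorial t) * real (num_vertices t + k))"
  using assms
proof (induction t arbitrary: k)
  case (Node ts)
  let ?N = "num_vertices (Node ts)"
  define \<alpha> where "\<alpha> = real ?N / real (tree_factorial (Node ts))"
  have "?N \<le> p" using Node.prems by simp
  from QR n_le n_pos p_le this have "b \<bullet> (c ^ k * elem_weight A (Node ts)) = \<alpha> / real (?N + k)"
  proof (cases rule: elem_weight_cases)
    case small
    have "b * (c ^ k * elem_weight A (Node ts)) = c ^ k * (b * elem_weight A (Node ts))"
      by (rule mult.left_commute)
    also have "\<dots> = \<alpha> *\<^sub>R (b * c ^ (?N + k - 1))"
      unfolding b_times_congQ[OF small] \<alpha>_def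
      by (simp add: scaleR_times_vec power_add ac_simps)
    finally have "b * (c ^ k * elem_weight A (Node ts)) = \<alpha> *\<^sub>R (b * c ^ (?N + k - 1))" .
    \<comment> \<open>Pairing with the all-ones vector turns the entrywise identity into one between
      inner products.\<close>
    moreover have "b \<bullet> (c ^ k * elem_weight A (Node ts)) = 1 \<bullet> (b * (c ^ k * elem_weight A (Node ts)))"
      unfolding inner_times_vec by simp
    ultimately have "b \<bullet> (c ^ k * elem_weight A (Node ts)) = \<alpha> * (b \<bullet> c ^ (?N + k - 1))"
      by (simp only: inner_scaleR_right) (simp add: inner_times_vec)
    moreover have "b \<bullet> c ^ (?N + k - 1) = 1 / real (?N + k)"
    proof -
      have "1 \<le> ?N + k" by simp
      then show ?thesis using B Node.prems unfolding cond_B_def by blast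
    qed
    ultimately show ?thesis by simp
  next
    case (large t' u y \<beta>)
    let ?\<Phi> = "elem_weight A t'"
    define k' where "k' = k + u"
    define T where "T = real (num_vertices t')"
    define G where "G = real (tree_factorial t')"
    have pos: "T > 0" "G > 0"
      by (simp_all add: T_def G_def num_vertices_pos tree_factorial_pos)
    \<comment> \<open>The large branch gives \<open>p \<ge> m + 2 > n\<close>, and
      \<open>p \<le> m + n + 1\<close> leaves at most \<open>n - 1\<close> for
      \<open>k + u\<close>.\<close>
    have bounds: "k' + 1 \<le> n" "n < p" "num_vertices t' + (k' + 1) \<le> p"
      using Node.prems large(2,3) p_le n_le n_pos by (simp_all add: k'_def)
    have "b * (c ^ k * y) = c ^ k * (b * y)" by (rule mult.left_commute)
    also have "\<dots> = \<beta> *\<^sub>R (b * c ^ k')"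
      unfolding b_times_congQ[OF large(5)]
      by (simp add: k'_def power_add scaleR_times_vec mult.left_commute)
    finally have "b * (c ^ k * y) = \<beta> *\<^sub>R (b * c ^ k')" .
    then have "b \<bullet> (c ^ k * elem_weight A (Node ts)) = \<beta> * (((b * c ^ k') v* A) \<bullet> ?\<Phi>)"
      by (simp add: large(6) inner_times_vec dot_lmul_matrix mult.assoc del: elem_weight.simps)
    \<comment> \<open>Hence \<open>A\<close> may be traded for entrywise multiplication by
      \<open>(1 - c ^ (k' + 1)) / (k' + 1)\<close>.\<close>
    moreover have "dvec A b c k' \<bullet> ?\<Phi> = 0"
      using bounds Dspace_dvec[of A b c k']
      by (intro Dspace_inner_elem_weight[of _ "Suc k'"]) auto
    then have "((b * c ^ k') v* A) \<bullet> ?\<Phi>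
        = (1 / real (k' + 1)) * (b \<bullet> (c ^ 0 * ?\<Phi>) - b \<bullet> (c ^ (k' + 1) * ?\<Phi>))"
      by (simp add: dvec_def inner_diff_left inner_times_vec right_diff_distrib)
    moreover have "b \<bullet> (c ^ 0 * ?\<Phi>) = T / (G * T)"
      using Node.IH[OF large(1), of 0] bounds by (simp add: T_def G_def)
    moreover have "b \<bullet> (c ^ (k' + 1) * ?\<Phi>) = T / (G * (T + real (k' + 1)))"
      using Node.IH[OF large(1), of "k' + 1"] bounds by (simp add: T_def G_def)
    ultimately have "b \<bullet> (c ^ k * elem_weight A (Node ts))
        = \<beta> * ((1 / real (k' + 1)) * (T / (G * T) - T / (G * (T + real (k' + 1)))))"
      by (simp only:)
    \<comment> \<open>The difference of the two fractions has numerator \<open>k' + 1\<close>, which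
      cancels the prefactor.\<close>
    also have "\<dots> = (\<beta> / G) / (T + real (k' + 1))"
      using pos by (simp add: divide_simps)
    also have "\<dots> = \<alpha> / real (?N + k)"
    proof -
      have "\<beta> / G = \<alpha>" using large(7) by (simp only: \<alpha>_def G_def)
      moreover have "T + real (k' + 1) = real (?N + k)"
        by (simp add: large(3) T_def k'_def del: num_vertices.simps)
      ultimately show ?thesis by (simp only:)
    qed
    finally show ?thesis .
  qed
  then show ?case by (simp add: \<alpha>_def)
qed

lemma order_at_least: "RK_order_at_least A b p"
  unfolding RK_order_at_least_def
  using b_inner_power_elem_weight[of _ 0] num_vertices_pos by simp

end

theorem theorem1p2:
  fixes A :: "real ^ ('s :: {finite, linorder}) ^ ('s :: {finite, linorder})"
    and b c :: "real ^ ('s :: {finite, linorder})"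
    and p m n :: nat
  assumes "explicit_RK A b c"
    and "p \<ge> 1"
    and "m \<ge> 1" and "n \<ge> 1" and "m \<ge> n - 1" and "m + n + 1 \<ge> p"
    and "cond_B b c p"
    and "cond_QO A b c m"
    and "cond_DO A b c p n"
    and "cond_QD_weak A b c m n"
    and "cond_PR A b c p m n"
    and "cond_QR A c m"
  shows "RK_order_at_least A b p"
proof -
  interpret simplified_RK A b c p m n by unfold_locales (use assms in auto)
  show ?thesis by (rule order_at_least)
qed

end
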